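(* Let $m\ge 1$, $\lambda\in\mathbb{C}\setminus\{0\}$, and let $\mathcal{H}^m_\lambda$ be the complex Hom-Lie algebra with basis $(x_1,\dots,x_m,y_1,\dots,y_m,z)$, with brackets $[x_i,y_j]=\delta_{ij}z=-[y_j,x_i]$ and all other brackets of basis vectors zero, and with twisting map $\alpha$ whose matrix in this basis is $$\begin{bmatrix}X&0&0\\0&Y&0\\0&0&\lambda\end{bmatrix},\qquad X,Y\in M_m(\mathbb{C}),\quad {}^tX\,Y=\lambda I_m .$$ Let $\mu(\mathcal{H}^m_\lambda)$ be the minimum of $\dim V$ over all faithful representations $(V,[\cdot,\cdot]_V,\beta)$ of $\mathcal{H}^m_\lambda$. Then $$\mu(\mathcal{H}^m_\lambda)=m+2.$$
   Context: Matrices of linear maps act on column vectors (columns are images of basis vectors). A Hom-Lie algebra is a triple $(\mathcal{G},[\cdot,\cdot],\alpha)$ with $\mathcal{G}$ a vector space, $[\cdot,\cdot]$ a skew-symmetric bilinear map $\mathcal{G}\times\mathcal{G}\to\mathcal{G}$, and $\alpha:\mathcal{G}\to\mathcal{G}$ linear, such that $[\alpha(x),[y,w]]+[\alpha(y),[w,x]]+[\alpha(w),[x,y]]=0$ for all $x,y,w$. It is multiplicative if $\alpha([x,y])=[\alpha(x),\alpha(y)]$. A representation of a multiplicative Hom-Lie algebra $(\mathcal{G},[\cdot,\cdot],\alpha)$ is a triple $(V,[\cdot,\cdot]_V,\beta)$ with $V$ a vector space, $\beta:V\to V$ linear, and $[\cdot,\cdot]_V:\mathcal{G}\times V\to V$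 bilinear, such that for all $x,y\in\mathcal{G}$, $v\in V$: $[\alpha(x),\beta(v)]_V=\beta([x,v]_V)$ and $[[x,y],\beta(v)]_V=[\alpha(x),[y,v]_V]_V-[\alpha(y),[x,v]_V]_V$. It is faithful if $\beta$ is an isomorphism and the map $\rho:\mathcal{G}\to\mathrm{End}(V)$, $\rho(x)=[x,\cdot]_V$, is injective. *)

theory Defs
  imports "HOL-Analysis.Analysis" "HOL-Library.Function_Algebras" "HOL-Library.Extended_Nat"
begin

section \<open>Hom-Lie algebras and their representations\<close>

locale hom_lie_algebra = vector_space scaleG
  for scaleG :: "'k::field \<Rightarrow> 'g::ab_group_add \<Rightarrow> 'g" +
  fixes bracket :: "'g \<Rightarrow> 'g \<Rightarrow> 'g"
    and alpha :: "'g \<Rightarrow> 'g"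
  assumes bracket_linear_left: "Vector_Spaces.linear scaleG scaleG (\<lambda>x. bracket x y)"
    and bracket_linear_right: "Vector_Spaces.linear scaleG scaleG (\<lambda>y. bracket x y)"
    and bracket_skew: "bracket x y = - bracket y x"
    and alpha_linear: "Vector_Spaces.linear scaleG scaleG alpha"
    and hom_jacobi: "bracket (alpha x) (bracket y w) + bracket (alpha y) (bracket w x)
                     + bracket (alpha w) (bracket x y) = 0"

locale multiplicative_hom_lie_algebra = hom_lie_algebra +
  assumes alpha_bracket: "alpha (bracket x y) = bracket (alpha x) (alpha y)"

text \<open>The representation space is a subspace \<open>V\<close> of an ambient vector space; the maps \<open>act\<close>
  and \<open>beta\<close> are total functions of which only the values on \<open>V\<close> are relevant.\<close>

locale hom_lie_representation =
  multiplicative_hom_lie_algebra scaleG bracket alpha + vs: vector_space scaleV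
  for scaleG :: "'k::field \<Rightarrow> 'g::ab_group_add \<Rightarrow> 'g"
    and bracket :: "'g \<Rightarrow> 'g \<Rightarrow> 'g"
    and alpha :: "'g \<Rightarrow> 'g"
    and scaleV :: "'k \<Rightarrow> 'v::ab_group_add \<Rightarrow> 'v" +
  fixes V :: "'v set"
    and act :: "'g \<Rightarrow> 'v \<Rightarrow> 'v"
    and beta :: "'v \<Rightarrow> 'v"
  assumes subspace_V: "vs.subspace V"
    and beta_closed: "v \<in> V \<Longrightarrow> beta v \<in> V"
    and beta_add: "v \<in> V \<Longrightarrow> w \<in> V \<Longrightarrow> beta (v + w) = beta v + beta w"
    and beta_scale: "v \<in> V \<Longrightarrow> beta (scaleV c v) = scaleV c (beta v)"
    and act_closed: "v \<in> V \<Longrightarrow> act x v \<in> V"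
    and act_add_left: "v \<in> V \<Longrightarrow> act (x + y) v = act x v + act y v"
    and act_scale_left: "v \<in> V \<Longrightarrow> act (scaleG c x) v = scaleV c (act x v)"
    and act_add_right: "v \<in> V \<Longrightarrow> w \<in> V \<Longrightarrow> act x (v + w) = act x v + act x w"
    and act_scale_right: "v \<in> V \<Longrightarrow> act x (scaleV c v) = scaleV c (act x v)"
    and act_alpha_beta: "v \<in> V \<Longrightarrow> act (alpha x) (beta v) = beta (act x v)"
    and act_bracket: "v \<in> V \<Longrightarrow>
          act (bracket x y) (beta v) = act (alpha x) (act y v) - act (alpha y) (act x v)"

locale faithful_hom_lie_representation = hom_lie_representation +
  assumes beta_bij: "bij_betw beta V V"
    and act_inj: "inj (\<lambda>x. restrict (act x) V)"

definition faithful_rep_on ::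
  "('k::field \<Rightarrow> 'g::ab_group_add \<Rightarrow> 'g) \<Rightarrow> ('g \<Rightarrow> 'g \<Rightarrow> 'g) \<Rightarrow> ('g \<Rightarrow> 'g)
    \<Rightarrow> ('k \<Rightarrow> 'v::ab_group_add \<Rightarrow> 'v) \<Rightarrow> 'v set \<Rightarrow> bool" where
  "faithful_rep_on scaleG bracket alpha scaleV V \<longleftrightarrow>
     (\<exists>act beta. faithful_hom_lie_representation scaleG bracket alpha scaleV V act beta)"

definition fin_dim :: "('k::field \<Rightarrow> 'v::ab_group_add \<Rightarrow> 'v) \<Rightarrow> 'v set \<Rightarrow> bool" where
  "fin_dim scaleV V \<longleftrightarrow> (\<exists>B. finite B \<and> V \<subseteq> module.span scaleV B)"

text \<open>Every finite-dimensional vector space is isomorphic to a subspace of the space of sequences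
  with pointwise operations, so the representation spaces can be taken there without loss of
  generality; \<open>faithful_rep_dims_complete\<close> below proves this for arbitrary ambient spaces.\<close>

definition seq_scale :: "'k::field \<Rightarrow> (nat \<Rightarrow> 'k) \<Rightarrow> nat \<Rightarrow> 'k" where
  "seq_scale c v = (\<lambda>i. c * v i)"

definition faithful_rep_dims ::
  "('k::field \<Rightarrow> 'g::ab_group_add \<Rightarrow> 'g) \<Rightarrow> ('g \<Rightarrow> 'g \<Rightarrow> 'g) \<Rightarrow> ('g \<Rightarrow> 'g) \<Rightarrow> nat set" where
  "faithful_rep_dims scaleG bracket alpha =
     {n. \<exists>V. faithful_rep_on scaleG bracket alpha seq_scale V
           \<and> fin_dim seq_scale V \<and> vector_space.dim seq_scale V = n}"

text \<open>The infimum is taken in \<open>enat\<close>, so it is \<open>\<infinity>\<close> if there is no finite-dimensional faithful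
  representation, and it is attained whenever it is finite.\<close>

definition min_faithful_dim ::
  "('k::field \<Rightarrow> 'g::ab_group_add \<Rightarrow> 'g) \<Rightarrow> ('g \<Rightarrow> 'g \<Rightarrow> 'g) \<Rightarrow> ('g \<Rightarrow> 'g) \<Rightarrow> enat" where
  "min_faithful_dim scaleG bracket alpha = (INF n \<in> faithful_rep_dims scaleG bracket alpha. enat n)"

lemma min_faithful_dim_eq_enat_iff:
  "min_faithful_dim scaleG bracket alpha = enat n \<longleftrightarrow>
     n \<in> faithful_rep_dims scaleG bracket alpha \<and>
     (\<forall>k \<in> faithful_rep_dims scaleG bracket alpha. n \<le> k)"
proof
  let ?D = "faithful_rep_dims scaleG bracket alpha"
  assume a: "min_faithful_dim scaleG bracket alpha = enat n"
  then have ne: "enat ` ?D \<noteq> {}"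
    by (auto simp: min_faithful_dim_def top_enat_def)
  then have "Inf (enat ` ?D) \<in> enat ` ?D"
    by (metis Inf_enat_def LeastI ex_in_conv)
  then have "n \<in> ?D" using a by (auto simp: min_faithful_dim_def)
  moreover have "\<forall>k\<in>?D. n \<le> k"
    using a by (metis INF_lower enat_ord_simps(1) min_faithful_dim_def)
  ultimately show "n \<in> ?D \<and> (\<forall>k\<in>?D. n \<le> k)" by simp
next
  assume "n \<in> faithful_rep_dims scaleG bracket alpha \<and>
     (\<forall>k \<in> faithful_rep_dims scaleG bracket alpha. n \<le> k)"
  then show "min_faithful_dim scaleG bracket alpha = enat n"
    unfolding min_faithful_dim_def
    by (intro antisym INF_greatest) (auto intro!: INF_lower)
qed

lemma vector_space_seq_scale: "vector_space (seq_scale :: 'k::field \<Rightarrow> _)"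
  by unfold_locales (auto simp: seq_scale_def fun_eq_iff algebra_simps)

lemma fun_sum_apply: "(\<Sum>c\<in>A. f c) x = (\<Sum>c\<in>A. f c x)" for f :: "'a \<Rightarrow> 'b \<Rightarrow> 'c::comm_monoid_add"
  by (induction A rule: infinite_finite_induct) auto

theorem faithful_rep_dims_complete:
  fixes scaleV :: "'k::field \<Rightarrow> 'v::ab_group_add \<Rightarrow> 'v"
  assumes rep: "faithful_rep_on scaleG bracket alpha scaleV V" and fd: "fin_dim scaleV V"
  shows "vector_space.dim scaleV V \<in> faithful_rep_dims scaleG bracket alpha"
proof -
  obtain act beta where
    "faithful_hom_lie_representation scaleG bracket alpha scaleV V act beta"
    using rep by (auto simp: faithful_rep_on_def)
  then interpret R: faithful_hom_lie_representation scaleG bracket alpha scaleV V act beta .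
  interpret S: vector_space "seq_scale :: 'k \<Rightarrow> _" by (rule vector_space_seq_scale)
  interpret P: vector_space_pair scaleV "seq_scale :: 'k \<Rightarrow> _" by unfold_locales
  obtain F where F: "finite F" "V \<subseteq> R.vs.span F" using fd by (auto simp: fin_dim_def)
  obtain B where B: "B \<subseteq> V" "R.vs.independent B" "V \<subseteq> R.vs.span B" "card B = R.vs.dim V"
    using R.vs.basis_exists by blast
  have finB: "finite B"
    using R.vs.independent_span_bound[OF F(1) B(2)] B(1) F(2) by auto
  have spanB: "R.vs.span B = V"
    using B R.subspace_V R.vs.span_minimal by blast
  obtain e where e: "bij_betw e B {..<card B}"
    using ex_bij_betw_finite_nat[OF finB] by (auto simp: atLeast0LessThan)
  define u :: "nat \<Rightarrow> nat \<Rightarrow> 'k" where "u = (\<lambda>n i. if i = n then 1 else 0)"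
  define phi where "phi = P.construct B (\<lambda>b. u (e b))"
  have lin: "Vector_Spaces.linear scaleV seq_scale phi"
    unfolding phi_def using B(2) by (rule P.linear_construct)
  interpret L: Vector_Spaces.linear scaleV "seq_scale :: 'k \<Rightarrow> _" phi by (rule lin)
  have phiB: "phi b = u (e b)" if "b \<in> B" for b
    unfolding phi_def using B(2) that by (rule P.construct_basis)
  have phi_eval: "phi v (e b) = R.vs.representation B v b" if v: "v \<in> V" and b: "b \<in> B" for v b
  proof -
    have "v = (\<Sum>c\<in>B. scaleV (R.vs.representation B v c) c)"
      using R.vs.sum_representation_eq[OF B(2) _ finB order_refl, of v] v spanB by simp
    then have "phi v = (\<Sum>c\<in>B. seq_scale (R.vs.representation B v c) (phi c))"
      by (metis (mono_tags, lifting) L.scale L.sum sum.cong)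
    then have "phi v (e b) = (\<Sum>c\<in>B. seq_scale (R.vs.representation B v c) (phi c)) (e b)"
      by simp
    also have "\<dots> = (\<Sum>c\<in>B. seq_scale (R.vs.representation B v c) (phi c) (e b))"
      by (rule fun_sum_apply)
    also have "\<dots> = (\<Sum>c\<in>B. if c = b then R.vs.representation B v c else 0)"
      using e b by (intro sum.cong refl) (auto simp: phiB u_def seq_scale_def bij_betw_def inj_on_def)
    finally show ?thesis using finB b by simp
  qed
  have inj: "inj_on phi V"
  proof (rule inj_onI)
    fix v w assume v: "v \<in> V" and w: "w \<in> V" and eq: "phi v = phi w"
    have "(\<Sum>c\<in>B. scaleV (R.vs.representation B v c) c)
        = (\<Sum>c\<in>B. scaleV (R.vs.representation B w c) c)"
      using phi_eval[OF v] phi_eval[OF w] eq by (intro sum.cong refl) metis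
    then show "v = w"
      using R.vs.sum_representation_eq[OF B(2) _ finB order_refl] v w spanB by metis
  qed
  define W where "W = phi ` V"
  define psi where "psi = inv_into V phi"
  have psi_V: "w \<in> W \<Longrightarrow> psi w \<in> V" and phi_psi: "w \<in> W \<Longrightarrow> phi (psi w) = w" for w
    by (auto simp: psi_def W_def inv_into_into f_inv_into_f)
  have psi_phi: "v \<in> V \<Longrightarrow> psi (phi v) = v" for v
    using inj by (simp add: psi_def)
  have phi_W: "v \<in> V \<Longrightarrow> phi v \<in> W" for v by (simp add: W_def)
  have W_sub: "S.subspace W"
    unfolding W_def using R.subspace_V by (rule L.subspace_image)
  note Vadd = R.vs.subspace_add[OF R.subspace_V] and Vscale = R.vs.subspace_scale[OF R.subspace_V]
    and Vdiff = R.vs.subspace_diff[OF R.subspace_V]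
  have psi_add: "psi (v + w) = psi v + psi w" if "v \<in> W" "w \<in> W" for v w
    using that by (metis L.add Vadd phi_psi psi_V psi_phi)
  have psi_scale: "psi (seq_scale c v) = scaleV c (psi v)" if "v \<in> W" for c v
    using that by (metis L.scale Vscale phi_psi psi_V psi_phi)
  define act' where "act' = (\<lambda>x w. phi (act x (psi w)))"
  define beta' where "beta' = (\<lambda>w. phi (beta (psi w)))"
  have "faithful_hom_lie_representation scaleG bracket alpha seq_scale W act' beta'"
  proof (unfold_locales, goal_cases)
    case 1 show ?case by (rule W_sub)
  next
    case (2 v) then show ?case by (simp add: beta'_def phi_W psi_V R.beta_closed)
  next
    case (3 v w) then show ?case by (simp add: beta'_def psi_add psi_V R.beta_add L.add)
  next
    case (4 v c) then show ?case by (simp add: beta'_def psi_scale psi_V R.beta_scale L.scale)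
  next
    case (5 v x) then show ?case by (simp add: act'_def phi_W psi_V R.act_closed)
  next
    case (6 v x y) then show ?case by (simp add: act'_def psi_V R.act_add_left L.add)
  next
    case (7 v c x) then show ?case by (simp add: act'_def psi_V R.act_scale_left L.scale)
  next
    case (8 v w x) then show ?case by (simp add: act'_def psi_add psi_V R.act_add_right L.add)
  next
    case (9 v x c) then show ?case by (simp add: act'_def psi_scale psi_V R.act_scale_right L.scale)
  next
    case (10 v x) then show ?case
      by (simp add: act'_def beta'_def psi_phi psi_V R.act_closed R.beta_closed R.act_alpha_beta)
  next
    case (11 v x y) then show ?case
      by (simp add: act'_def beta'_def psi_phi psi_V R.act_closed R.beta_closed R.act_bracket
            L.diff)
  next
    case 12
    have "bij_betw psi W V"
      unfolding psi_def W_def using inj by (simp add: bij_betw_inv_into inj_on_imp_bij_betw)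
    moreover have "bij_betw phi V W" using inj by (simp add: W_def inj_on_imp_bij_betw)
    ultimately have "bij_betw (phi \<circ> (beta \<circ> psi)) W W"
      using R.beta_bij by (blast intro: bij_betw_trans)
    then show ?case by (simp add: beta'_def comp_def)
  next
    case 13
    show ?case
    proof (rule injI)
      fix x y assume eq: "restrict (act' x) W = restrict (act' y) W"
      have "act x v = act y v" if v: "v \<in> V" for v
      proof -
        have "act' x (phi v) = act' y (phi v)"
          using fun_cong[OF eq, of "phi v"] phi_W[OF v] by simp
        then have "phi (act x v) = phi (act y v)" using v by (simp add: act'_def psi_phi)
        then show ?thesis using inj_onD[OF inj] R.act_closed v by blast
      qed
      then have "restrict (act x) V = restrict (act y) V" by (auto simp: restrict_def)
      then show "x = y" using R.act_inj by (auto dest: injD)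
    qed
  qed
  then have "faithful_rep_on scaleG bracket alpha seq_scale W"
    by (auto simp: faithful_rep_on_def)
  moreover have span_W: "S.span (phi ` B) = W"
    using L.span_image[of B] spanB by (simp add: W_def)
  have "fin_dim seq_scale W"
    unfolding fin_dim_def using finB span_W by (intro exI[of _ "phi ` B"]) auto
  moreover have "S.dim W = R.vs.dim V"
  proof -
    have "S.independent (phi ` B)"
      using B(2) inj spanB by (intro P.linear_independent_injective_image[OF lin]) auto
    then have "S.dim W = card (phi ` B)" using S.dim_span_eq_card_independent span_W by metis
    also have "\<dots> = card B" using inj B(1) by (meson card_image inj_on_subset)
    finally show ?thesis using B(4) by simp
  qed
  ultimately show ?thesis by (auto simp: faithful_rep_dims_def)
qed

section \<open>The Heisenberg Hom-Lie algebras\<close>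

text \<open>The basis \<open>(x\<^sub>1,\<dots>,x\<^sub>m,y\<^sub>1,\<dots>,y\<^sub>m,z)\<close> is indexed by \<open>'m + 'm + unit\<close>, where \<open>m = CARD('m)\<close>;
  since types are nonempty, \<open>m \<ge> 1\<close>.\<close>

abbreviation ix :: "'m \<Rightarrow> 'm + 'm + unit" where "ix i \<equiv> Inl i"
abbreviation iy :: "'m \<Rightarrow> 'm + 'm + unit" where "iy j \<equiv> Inr (Inl j)"
abbreviation iz :: "'m + 'm + unit" where "iz \<equiv> Inr (Inr ())"

fun heis_basis_bracket ::
  "'m + 'm + unit \<Rightarrow> 'm + 'm + unit \<Rightarrow> complex ^ ('m::finite + 'm + unit)" where
  "heis_basis_bracket (Inl i) (Inr (Inl j)) = (if i = j then axis iz 1 else 0)"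
| "heis_basis_bracket (Inr (Inl j)) (Inl i) = (if i = j then - axis iz 1 else 0)"
| "heis_basis_bracket _ _ = 0"

definition heis_bracket ::
  "complex ^ ('m::finite + 'm + unit) \<Rightarrow> complex ^ ('m + 'm + unit) \<Rightarrow> complex ^ ('m + 'm + unit)"
  where "heis_bracket u v = (\<Sum>p\<in>UNIV. \<Sum>q\<in>UNIV. (u $ p * v $ q) *s heis_basis_bracket p q)"

fun heis_twist_entry ::
  "complex ^ 'm ^ 'm \<Rightarrow> complex ^ 'm ^ 'm \<Rightarrow> complex
    \<Rightarrow> ('m::finite) + 'm + unit \<Rightarrow> 'm + 'm + unit \<Rightarrow> complex" where
  "heis_twist_entry X Y lam (Inl i) (Inl j) = X $ i $ j"
| "heis_twist_entry X Y lam (Inr (Inl i)) (Inr (Inl j)) = Y $ i $ j"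
| "heis_twist_entry X Y lam (Inr (Inr _)) (Inr (Inr _)) = lam"
| "heis_twist_entry X Y lam _ _ = 0"

definition heis_twist ::
  "complex ^ 'm ^ 'm \<Rightarrow> complex ^ 'm ^ 'm \<Rightarrow> complex
    \<Rightarrow> complex ^ ('m::finite + 'm + unit) ^ ('m + 'm + unit)" where
  "heis_twist X Y lam = (\<chi> p q. heis_twist_entry X Y lam p q)"

lemma heis_bracket_axis: "heis_bracket (axis p 1) (axis q 1) = heis_basis_bracket p q"
proof -
  have "heis_bracket (axis p 1) (axis q 1)
      = (\<Sum>p'\<in>UNIV. \<Sum>q'\<in>UNIV. if p' = p then if q' = q then heis_basis_bracket p' q' else 0 else 0)"
    unfolding heis_bracket_def by (intro sum.cong refl) (auto simp: axis_def)
  also have "\<dots> = (\<Sum>p'\<in>UNIV. if p' = p then heis_basis_bracket p' q else 0)"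
    by (intro sum.cong refl) auto
  finally show ?thesis by simp
qed

lemma sum_UNIV_heis: "(\<Sum>p\<in>UNIV. f p) = (\<Sum>i\<in>UNIV. f (ix i)) + ((\<Sum>j\<in>UNIV. f (iy j)) + f iz)"
  for f :: "('m::finite) + 'm + unit \<Rightarrow> 'b::comm_monoid_add"
  by (simp add: UNIV_Plus_UNIV[symmetric] sum.Plus del: UNIV_Plus_UNIV) (simp add: UNIV_unit)

lemma heis_bracket_eq:
  "heis_bracket u v = (\<Sum>i\<in>UNIV. u $ ix i * v $ iy i - u $ iy i * v $ ix i) *s axis iz 1"
proof -
  have "heis_bracket u v
      = (\<Sum>i\<in>UNIV. \<Sum>j\<in>UNIV. if i = j then (u $ ix i * v $ iy j) *s axis iz 1 else 0)
      + (\<Sum>i\<in>UNIV. \<Sum>j\<in>UNIV. if i = j then (u $ iy i * v $ ix j) *s (- axis iz 1) else 0)"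
    unfolding heis_bracket_def sum_UNIV_heis
    by (simp add: sum.distrib if_distrib[of "\<lambda>x. _ *s x"] eq_commute cong: if_cong)
  also have "\<dots> = (\<Sum>i\<in>UNIV. u $ ix i * v $ iy i - u $ iy i * v $ ix i) *s axis iz 1"
    by (simp add: vec.scale_sum_left vec.scale_left_diff_distrib sum.distrib[symmetric])
  finally show ?thesis .
qed

theorem heis_multiplicative_hom_lie_algebra:
  fixes X Y :: "complex ^ 'm::finite ^ 'm"
  assumes XY: "transpose X ** Y = mat lam"
  shows "multiplicative_hom_lie_algebra (*s) heis_bracket ((*v) (heis_twist X Y lam))"
proof -
  let ?al = "(*v) (heis_twist X Y lam)"
  have lin_l: "Vector_Spaces.linear (*s) (*s) (\<lambda>u. heis_bracket u v)" for v :: "complex ^ ('m + 'm + unit)"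
    by unfold_locales
      (auto simp: heis_bracket_eq vec_eq_iff axis_def algebra_simps sum.distrib sum_subtractf sum_distrib_left)
  have lin_r: "Vector_Spaces.linear (*s) (*s) (\<lambda>v. heis_bracket u v)" for u :: "complex ^ ('m + 'm + unit)"
    by unfold_locales
      (auto simp: heis_bracket_eq vec_eq_iff axis_def algebra_simps sum.distrib sum_subtractf sum_distrib_left)
  have skew: "heis_bracket u v = - heis_bracket v u" for u v :: "complex ^ ('m + 'm + unit)"
    by (auto simp: heis_bracket_eq vec_eq_iff axis_def algebra_simps sum_subtractf)
  have tx: "(?al u) $ ix i = (X *v (\<chi> j. u $ ix j)) $ i" for u i
    by (simp add: matrix_vector_mult_def heis_twist_def sum_UNIV_heis)
  have ty: "(?al u) $ iy i = (Y *v (\<chi> j. u $ iy j)) $ i" for u i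
    by (simp add: matrix_vector_mult_def heis_twist_def sum_UNIV_heis)
  have tz: "(?al u) $ iz = lam * u $ iz" for u
    by (simp add: matrix_vector_mult_def heis_twist_def sum_UNIV_heis)
  have pair: "(\<Sum>i\<in>UNIV. (X *v a) $ i * (Y *v b) $ i) = lam * (\<Sum>i\<in>UNIV. a $ i * b $ i)" for a b
  proof -
    have e: "(\<Sum>i\<in>UNIV. X $ i $ j * Y $ i $ k) = (if j = k then lam else 0)" for j k
      using arg_cong[OF XY, of "\<lambda>M. M $ j $ k"]
      by (simp add: matrix_matrix_mult_def transpose_def mat_def)
    have "(\<Sum>i\<in>UNIV. (X *v a) $ i * (Y *v b) $ i)
        = (\<Sum>i\<in>UNIV. \<Sum>j\<in>UNIV. \<Sum>k\<in>UNIV. a $ j * b $ k * (X $ i $ j * Y $ i $ k))"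
      by (simp add: matrix_vector_mult_def sum_product mult_ac)
    also have "\<dots> = (\<Sum>j\<in>UNIV. \<Sum>k\<in>UNIV. \<Sum>i\<in>UNIV. a $ j * b $ k * (X $ i $ j * Y $ i $ k))"
      by (subst sum.swap) (intro sum.cong refl sum.swap)
    also have "\<dots> = (\<Sum>j\<in>UNIV. \<Sum>k\<in>UNIV. if j = k then lam * (a $ j * b $ j) else 0)"
      by (intro sum.cong refl) (auto simp: sum_distrib_left[symmetric] e)
    finally show ?thesis by (simp add: sum_distrib_left)
  qed
  have mult: "?al (heis_bracket u v) = heis_bracket (?al u) (?al v)" for u v
  proof -
    have ax: "?al (axis iz 1) = lam *s axis iz 1"
    proof (rule vec_eq_iff[THEN iffD2], rule allI)
      fix p show "?al (axis iz 1) $ p = (lam *s axis iz 1) $ p"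
        by (cases "(X, Y, lam, p, iz :: 'm + 'm + unit)" rule: heis_twist_entry.cases)
           (simp_all add: axis_def matrix_vector_mult_def sum_UNIV_heis heis_twist_def)
    qed
    have "(\<Sum>i\<in>UNIV. ?al u $ ix i * ?al v $ iy i - ?al u $ iy i * ?al v $ ix i)
        = lam * (\<Sum>i\<in>UNIV. u $ ix i * v $ iy i - u $ iy i * v $ ix i)"
      using pair[of "\<chi> j. u $ ix j" "\<chi> j. v $ iy j"] pair[of "\<chi> j. v $ ix j" "\<chi> j. u $ iy j"]
      by (simp add: tx ty sum_subtractf mult.commute right_diff_distrib)
    then show ?thesis
      by (simp add: heis_bracket_eq vector_scalar_commute ax mult.commute)
  qed
  have central: "heis_bracket u (heis_bracket v w) = 0" for u v w :: "complex ^ ('m + 'm + unit)"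
    by (simp add: heis_bracket_eq[of u] heis_bracket_eq[of v] axis_def)
  show ?thesis
    by (intro multiplicative_hom_lie_algebra.intro hom_lie_algebra.intro
        hom_lie_algebra_axioms.intro multiplicative_hom_lie_algebra_axioms.intro
        vec.vector_space_axioms lin_l lin_r skew mult vec.linear_axioms)
       (simp add: central)
qed

end

theory Submission
  imports Defs
begin

text \<open>For the lower bound, let \<open>m = CARD('m)\<close>, let \<open>z\<close> be the central basis vector and
  \<open>\<rho>\<close> the action. Some \<open>v\<close> in \<open>V\<close> has \<open>\<rho>(z)v\<close> outside the line of \<open>\<beta>v\<close>: otherwise
  \<open>\<rho>(z) = c\<beta>\<close> with \<open>c \<noteq> 0\<close>, and the commutator of \<open>\<beta>\<inverse>\<rho>(x\<^sub>1)\<close> and \<open>\<beta>\<inverse>\<rho>(y\<^sub>1)\<close> would be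
  the scalar \<open>c\<close>, contradicting that it has trace zero. For such a \<open>v\<close> the space \<open>K\<close> of all
  \<open>u\<close> with \<open>\<rho>(u)v\<close> in the line of \<open>\<beta>v\<close> is isotropic for the bracket and meets the line of \<open>z\<close>
  trivially. Hence \<open>K\<close>, of dimension \<open>r\<close>, has trivial intersection both with a complement, of
  dimension \<open>2m + 1 - r\<close>, and with the span of \<open>z\<close> and the conjugate of \<open>K\<close> rotated by the
  symplectic form, of dimension \<open>r + 1\<close>. Both spaces embed into \<open>V\<close> modulo the line of
  \<open>\<beta>v\<close>; adding the two inequalities gives \<open>2 dim V \<ge> 2m + 4\<close>.

  For the upper bound, twist the standard representation of the Heisenberg Lie algebra by upper
  triangular matrices of size \<open>m + 2\<close> by \<open>\<beta> = diag(\<lambda>, Y, 1)\<close>.\<close>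

section \<open>Linear algebra: traces, scalar multiples and dimension counts\<close>

text \<open>The maps of a representation are total functions whose linearity is known only on
  \<open>V\<close>; hence linearity is assumed on a subspace, here and in the next lemmas.\<close>

lemma (in vector_space) linear_on_sum:
  assumes V: "subspace V"
    and add: "\<And>v w. v \<in> V \<Longrightarrow> w \<in> V \<Longrightarrow> f (v + w) = f v + f w"
    and sc: "\<And>c v. v \<in> V \<Longrightarrow> f (scale c v) = scale c (f v)"
    and "A \<subseteq> V"
  shows "f (\<Sum>a\<in>A. scale (g a) a) = (\<Sum>a\<in>A. scale (g a) (f a))"
proof -
  have f0: "f 0 = 0"
    using sc[of 0 0] subspace_0[OF V] by simp
  show ?thesis
    using \<open>A \<subseteq> V\<close>
  proof (induction A rule: infinite_finite_induct)
    case (insert a A)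
    then show ?case
      by (simp add: add sc subspace_scale[OF V] subspace_sum[OF V] subset_eq)
  qed (auto simp: f0)
qed

text \<open>The two composites of \<open>S\<close> and \<open>T\<close> have equal traces on
  \<open>V\<close>, while the scalar \<open>c\<close> has trace \<open>dim V * c\<close>. This
  product is required to be nonzero in the field, since in positive characteristic a commutator can
  be a nonzero scalar.\<close>

lemma (in vector_space) commutator_not_scalar:
  assumes V: "subspace V" and F: "finite F" "V \<subseteq> span F"
    and Sc: "\<And>v. v \<in> V \<Longrightarrow> S v \<in> V"
    and Sadd: "\<And>v w. v \<in> V \<Longrightarrow> w \<in> V \<Longrightarrow> S (v + w) = S v + S w"
    and Ss: "\<And>c v. v \<in> V \<Longrightarrow> S (scale c v) = scale c (S v)"
    and Tc: "\<And>v. v \<in> V \<Longrightarrow> T v \<in> V"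
    and Tadd: "\<And>v w. v \<in> V \<Longrightarrow> w \<in> V \<Longrightarrow> T (v + w) = T v + T w"
    and Ts: "\<And>c v. v \<in> V \<Longrightarrow> T (scale c v) = scale c (T v)"
    and comm: "\<And>v. v \<in> V \<Longrightarrow> S (T v) - T (S v) = scale c v"
    and c: "of_nat (dim V) * c \<noteq> 0"
  shows False
proof -
  obtain B where B: "B \<subseteq> V" "independent B" "V \<subseteq> span B" "card B = dim V"
    using basis_exists by blast
  have fin: "finite B"
    using independent_span_bound[OF F(1) B(2)] B(1) F(2) by auto
  have spB: "span B = V"
    using B V span_minimal by blast
  let ?r = "representation B"
  \<comment> \<open>The trace of a composite in terms of the matrix entries of its factors. Swapping
    the two summations exchanges the roles of \<open>f\<close> and \<open>g\<close>.\<close>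
  have tr: "(\<Sum>b\<in>B. ?r (f (g b)) b) = (\<Sum>b\<in>B. \<Sum>d\<in>B. ?r (g b) d * ?r (f d) b)"
    if fc: "\<And>v. v \<in> V \<Longrightarrow> f v \<in> V"
      and "\<And>v w. v \<in> V \<Longrightarrow> w \<in> V \<Longrightarrow> f (v + w) = f v + f w"
      and "\<And>c v. v \<in> V \<Longrightarrow> f (scale c v) = scale c (f v)"
      and gc: "\<And>v. v \<in> V \<Longrightarrow> g v \<in> V" for f g
  proof (intro sum.cong refl)
    fix b assume b: "b \<in> B"
    have "g b = (\<Sum>d\<in>B. scale (?r (g b) d) d)"
      using sum_representation_eq[OF B(2) _ fin order_refl, of "g b"] gc b B(1) spB by auto
    then have "f (g b) = (\<Sum>d\<in>B. scale (?r (g b) d) (f d))"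
      using linear_on_sum[OF V that(2,3) B(1), of "?r (g b)"] by simp
    moreover have "\<And>d. d \<in> B \<Longrightarrow> scale (?r (g b) d) (f d) \<in> span B"
      using fc B(1) subspace_scale[OF V] by (auto simp: spB)
    ultimately have "?r (f (g b)) b = (\<Sum>d\<in>B. ?r (scale (?r (g b) d) (f d)) b)"
      using representation_sum[OF B(2), of B "\<lambda>d. scale (?r (g b) d) (f d)"] by simp
    also have "\<dots> = (\<Sum>d\<in>B. ?r (g b) d * ?r (f d) b)"
      using fc B by (intro sum.cong refl) (auto simp: representation_scale spB)
    finally show "?r (f (g b)) b = \<dots>" .
  qed
  have "(\<Sum>b\<in>B. ?r (S (T b)) b) = (\<Sum>b\<in>B. \<Sum>d\<in>B. ?r (T b) d * ?r (S d) b)"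
    by (rule tr) (fact Sc Sadd Ss Tc)+
  also have "\<dots> = (\<Sum>b\<in>B. \<Sum>d\<in>B. ?r (S b) d * ?r (T d) b)"
    by (subst sum.swap) (simp add: mult.commute)
  also have "\<dots> = (\<Sum>b\<in>B. ?r (T (S b)) b)"
    by (rule tr[symmetric]) (fact Tc Tadd Ts Sc)+
  finally have "(\<Sum>b\<in>B. ?r (S (T b)) b) = (\<Sum>b\<in>B. ?r (T (S b)) b)" .
  moreover have "?r (S (T b)) b - ?r (T (S b)) b = c" if b: "b \<in> B" for b
  proof -
    have bV: "b \<in> V" using b B(1) by auto
    have "?r (S (T b)) b - ?r (T (S b)) b = ?r (S (T b) - T (S b)) b"
      using bV by (simp add: representation_diff B(2) spB Sc Tc)
    also have "\<dots> = c"
      using bV b by (simp add: comm representation_scale B(2) spB representation_basis)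
    finally show ?thesis .
  qed
  then have "(\<Sum>b\<in>B. ?r (S (T b)) b) - (\<Sum>b\<in>B. ?r (T (S b)) b) = of_nat (card B) * c"
    by (simp add: sum_subtractf[symmetric])
  ultimately show False using c B(4) by simp
qed

text \<open>The factors at \<open>v\<close>, at a fixed nonzero \<open>v0\<close> and at
  \<open>v + v0\<close> are compared; injectivity of \<open>h\<close> turns the comparison into a
  linear relation between \<open>v\<close> and \<open>v0\<close>.\<close>

lemma (in vector_space) pointwise_scalar_imp_scalar:
  assumes V: "subspace V"
    and gadd: "\<And>v w. v \<in> V \<Longrightarrow> w \<in> V \<Longrightarrow> g (v + w) = g v + g w"
    and gs: "\<And>c v. v \<in> V \<Longrightarrow> g (scale c v) = scale c (g v)"
    and hadd: "\<And>v w. v \<in> V \<Longrightarrow> w \<in> V \<Longrightarrow> h (v + w) = h v + h w"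
    and hs: "\<And>c v. v \<in> V \<Longrightarrow> h (scale c v) = scale c (h v)"
    and inj: "inj_on h V"
    and pt: "\<And>v. v \<in> V \<Longrightarrow> \<exists>c. g v = scale c (h v)"
  obtains c where "\<And>v. v \<in> V \<Longrightarrow> g v = scale c (h v)"
proof (cases "V \<subseteq> {0}")
  case True
  have "g v = scale 0 (h v)" if "v \<in> V" for v
    using gs[OF that, of 0] True that by auto
  then show ?thesis using that by blast
next
  case False
  then obtain v0 where v0: "v0 \<in> V" "v0 \<noteq> 0" by auto
  then obtain c0 where c0: "g v0 = scale c0 (h v0)" using pt by blast
  have "g v = scale c0 (h v)" if v: "v \<in> V" for v
  proof -
    obtain c where c: "g v = scale c (h v)" using pt v by blast
    obtain d where d: "g (v + v0) = scale d (h (v + v0))"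
      using pt subspace_add[OF V v v0(1)] by blast
    have "scale c (h v) + scale c0 (h v0) = scale d (h v) + scale d (h v0)"
      using d by (simp add: gadd hadd v v0 c c0 scale_right_distrib)
    then have "scale (c - d) (h v) = scale (d - c0) (h v0)"
      by (simp add: algebra_simps)
    then have "h (scale (c - d) v) = h (scale (d - c0) v0)"
      by (simp add: hs v v0)
    then have eq: "scale (c - d) v = scale (d - c0) v0"
      using inj_onD[OF inj] subspace_scale[OF V] v v0(1) by blast
    show ?thesis
    \<comment> \<open>If \<open>c = d\<close>, the relation forces \<open>d = c0\<close> because
      \<open>v0\<close> is nonzero. Otherwise \<open>v\<close> is a multiple of \<open>v0\<close>
      and inherits its factor.\<close>
    proof (cases "c = d")
      case True
      then show ?thesis using eq v0 c by simp
    next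
      case False
      then have "v = scale (inverse (c - d)) (scale (c - d) v)" by simp
      then have "v = scale (inverse (c - d) * (d - c0)) v0" by (simp add: eq)
      then show ?thesis
        using v0 c0 by (metis gs hs scale_left_commute)
    qed
  qed
  then show ?thesis using that by blast
qed

text \<open>The coordinates of \<open>v\<close> in the basis \<open>B\<close> are supported both
  inside and outside \<open>A\<close>, so all of them vanish.\<close>

lemma (in vector_space) span_disjoint_independent:
  assumes B: "independent B" and v: "v \<in> span A" "v \<in> span (B - A)" and "A \<subseteq> B"
  shows "v = 0"
proof -
  have "representation A v = representation B v"
    using representation_extend[OF B v(1)] assms by simp
  moreover have "representation (B - A) v = representation B v"
    using representation_extend[OF B v(2)] by simp
  ultimately have "{b. representation A v b \<noteq> 0} = {}"
    using representation_ne_zero by (metis (mono_tags, lifting) DiffD2 Collect_empty_eq)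
  moreover have "(\<Sum>b | representation A v b \<noteq> 0. scale (representation A v b) b) = v"
    using B v(1) \<open>A \<subseteq> B\<close> independent_mono by (intro sum_nonzero_representation_eq) auto
  ultimately show ?thesis by simp
qed

text \<open>In effect \<open>f\<close> embeds the span of \<open>I\<close> into \<open>V\<close>
  modulo the line of \<open>w\<close>. In \<open>disj\<close>, the factor 0 gives injectivity and
  the factor 1 keeps \<open>w\<close> out of the image; adjoining \<open>w\<close> makes the
  inequality strict.\<close>

lemma (in vector_space_pair) card_less_dim:
  assumes lin: "Vector_Spaces.linear s1 s2 f"
    and I: "vs1.independent I"
    and V: "vs2.subspace V" and F: "finite F" "V \<subseteq> vs2.span F"
    and fV: "\<And>u. f u \<in> V" and w: "w \<in> V" "w \<noteq> 0"
    and disj: "\<And>u c. u \<in> vs1.span I \<Longrightarrow> f u = s2 c w \<Longrightarrow> u = 0"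
  shows "card I < vs2.dim V"
proof -
  interpret L: Vector_Spaces.linear s1 s2 f by (rule lin)
  have inj: "inj_on f (vs1.span I)"
  proof (rule inj_onI)
    fix u v assume u: "u \<in> vs1.span I" "v \<in> vs1.span I" "f u = f v"
    then have "f (u - v) = s2 0 w" by (simp add: L.diff)
    then show "u = v" using disj[of "u - v" 0] vs1.span_diff u by simp
  qed
  have ind: "vs2.independent (f ` I)"
    using I inj by (rule linear_independent_injective_image[OF lin])
  have "w \<notin> vs2.span (f ` I)"
  proof
    assume "w \<in> vs2.span (f ` I)"
    then obtain u where u: "u \<in> vs1.span I" "f u = w"
      using L.span_image by auto
    then have "u = 0" using disj[of u 1] by simp
    then show False using u w by (simp add: L.zero)
  qed
  then have ind': "vs2.independent (insert w (f ` I))" and ni: "w \<notin> f ` I"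
    using ind vs2.independent_insertI vs2.span_base by blast+
  obtain B where B: "B \<subseteq> V" "vs2.independent B" "V \<subseteq> vs2.span B" "card B = vs2.dim V"
    using vs2.basis_exists by blast
  have "finite B"
    using vs2.independent_span_bound[OF F(1) B(2)] B(1) F(2) by auto
  moreover have "insert w (f ` I) \<subseteq> vs2.span B"
    using B(3) fV w by auto
  ultimately have le: "finite (insert w (f ` I))" "card (insert w (f ` I)) \<le> vs2.dim V"
    using vs2.independent_span_bound[OF _ ind', of B] B(4) by metis+
  moreover have "card (f ` I) = card I"
    using inj vs1.span_superset by (meson card_image inj_on_subset)
  ultimately show ?thesis using ni by simp
qed

section \<open>Conjugate rotation by the symplectic form\<close>

text \<open>The standard complex structure on the \<open>x\<close> and \<open>y\<close> coordinates,
  composed with complex conjugation, with the \<open>z\<close> coordinate dropped. Conjugation makes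
  the pairing of \<open>u\<close> with its image a Hermitian square rather than a sum of complex
  squares, which could cancel.\<close>

definition heis_conj ::
  "complex ^ ('m::finite + 'm + unit) \<Rightarrow> complex ^ ('m + 'm + unit)" where
  "heis_conj u = (\<chi> p. case p of Inl i \<Rightarrow> - cnj (u $ iy i)
     | Inr (Inl j) \<Rightarrow> cnj (u $ ix j) | Inr (Inr _) \<Rightarrow> 0)"

lemma heis_conj_nth [simp]:
  "heis_conj u $ ix i = - cnj (u $ iy i)"
  "heis_conj u $ iy i = cnj (u $ ix i)"
  "heis_conj u $ iz = 0"
  by (simp_all add: heis_conj_def)

lemma heis_vec_eq_iff:
  "u = v \<longleftrightarrow> (\<forall>i. u $ ix i = v $ ix i) \<and> (\<forall>i. u $ iy i = v $ iy i) \<and> u $ iz = v $ iz"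
  for u v :: "complex ^ ('m::finite + 'm + unit)"
  by (auto simp: vec_eq_iff split_sum_all)

lemma heis_conj_eq_0_iff:
  "heis_conj u = 0 \<longleftrightarrow> (\<forall>i. u $ ix i = 0 \<and> u $ iy i = 0)"
  by (auto simp: heis_vec_eq_iff)

lemma heis_conj_add: "heis_conj (u + v) = heis_conj u + heis_conj v"
  by (simp add: heis_vec_eq_iff)

lemma heis_conj_scale: "heis_conj (c *s u) = cnj c *s heis_conj u"
  by (simp add: heis_vec_eq_iff)

lemma heis_conj_sum: "heis_conj (\<Sum>a\<in>A. c a *s g a) = (\<Sum>a\<in>A. cnj (c a) *s heis_conj (g a))"
proof (induction A rule: infinite_finite_induct)
  case (insert a A)
  then show ?case by (simp add: heis_conj_add heis_conj_scale)
qed (simp_all add: heis_conj_eq_0_iff)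

text \<open>The \<open>z\<close> coordinate of the bracket is the sum of the squared moduli of the
  \<open>x\<close> and \<open>y\<close> coordinates of \<open>u\<close>.\<close>

lemma heis_bracket_conj_eq_0:
  assumes "heis_bracket u (heis_conj u) = 0"
  shows "heis_conj u = 0"
proof -
  have "(\<Sum>i\<in>UNIV. u $ ix i * cnj (u $ ix i) + u $ iy i * cnj (u $ iy i)) = 0"
    using assms by (simp add: heis_bracket_eq heis_vec_eq_iff axis_def)
  then have "(\<Sum>i\<in>UNIV. (cmod (u $ ix i))\<^sup>2 + (cmod (u $ iy i))\<^sup>2) = 0"
    by (simp only: complex_norm_square[symmetric] of_real_add[symmetric] of_real_sum[symmetric]
        of_real_eq_0_iff)
  then show ?thesis
    by (simp add: sum_nonneg_eq_0_iff heis_conj_eq_0_iff add_nonneg_eq_0_iff)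
qed

lemma heis_twist_nth:
  "(heis_twist X Y lam *v u) $ ix i = (X *v (\<chi> j. u $ ix j)) $ i"
  "(heis_twist X Y lam *v u) $ iy i = (Y *v (\<chi> j. u $ iy j)) $ i"
  "(heis_twist X Y lam *v u) $ iz = lam * u $ iz"
  by (simp_all add: matrix_vector_mult_def heis_twist_def sum_UNIV_heis)

lemma heis_twist_iz: "heis_twist X Y lam *v axis iz 1 = lam *s axis iz 1"
  by (simp add: heis_vec_eq_iff heis_twist_nth axis_def zero_vec_def[symmetric])

section \<open>Lower bound\<close>

lemma heis_faithful_obtain_vector:
  fixes X Y :: "complex ^ 'm::finite ^ 'm"
    and scaleV :: "complex \<Rightarrow> 'v::ab_group_add \<Rightarrow> 'v"
  assumes rep: "faithful_hom_lie_representation (*s) heis_bracket ((*v) (heis_twist X Y lam))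
      scaleV V act beta"
    and fd: "fin_dim scaleV V"
  obtains v where "v \<in> V" "\<And>c. act (axis iz 1) v \<noteq> scaleV c (beta v)"
proof (rule ccontr)
  assume na: "\<not> thesis"
  note witness = that
  interpret R: faithful_hom_lie_representation "(*s)" heis_bracket "(*v) (heis_twist X Y lam)"
    scaleV V act beta by (rule rep)
  define z :: "complex ^ ('m + 'm + unit)" where "z = axis iz 1"
  have inj: "inj_on beta V" and onto: "beta ` V = V"
    using R.beta_bij by (auto simp: bij_betw_def)
  have pt: "\<exists>c. act z v = scaleV c (beta v)" if "v \<in> V" for v
    using na witness that unfolding z_def by blast
  obtain c where c: "\<And>v. v \<in> V \<Longrightarrow> act z v = scaleV c (beta v)"
    by (rule R.vs.pointwise_scalar_imp_scalar[OF R.subspace_V _ _ _ _ inj pt])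
      (use R.act_add_right R.act_scale_right R.beta_add R.beta_scale in blast)+
  \<comment> \<open>Faithfulness separates \<open>z\<close> from 0. This yields both
    \<open>c \<noteq> 0\<close> and \<open>dim V > 0\<close>, as the trace argument
    requires.\<close>
  have "\<exists>v\<in>V. act z v \<noteq> 0"
  proof (rule ccontr)
    assume "\<not> (\<exists>v\<in>V. act z v \<noteq> 0)"
    moreover have "act 0 v = 0" if "v \<in> V" for v
      using R.act_scale_left[OF that, of 0 z] by simp
    ultimately have "restrict (act z) V = restrict (act 0) V"
      by (auto simp: restrict_def)
    then have "z = 0" using R.act_inj by (auto dest: injD)
    then show False by (simp add: z_def axis_eq_0_iff)
  qed
  then obtain v0 where v0: "v0 \<in> V" "act z v0 \<noteq> 0" by blast
  then have c0: "c \<noteq> 0" using c by auto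
  obtain F where F: "finite F" "V \<subseteq> R.vs.span F" using fd by (auto simp: fin_dim_def)
  have dim: "R.vs.dim V > 0"
  proof -
    have "v0 \<noteq> 0" using v0 R.act_scale_right[of 0 z 0] R.vs.subspace_0[OF R.subspace_V] by auto
    moreover obtain B where B: "B \<subseteq> V" "R.vs.independent B" "V \<subseteq> R.vs.span B"
        "card B = R.vs.dim V"
      using R.vs.basis_exists by blast
    ultimately have "B \<noteq> {}" using v0(1) by auto
    moreover have "finite B"
      using R.vs.independent_span_bound[OF F(1) B(2)] B(1) F(2) by auto
    ultimately show ?thesis using B(4) by (metis card_gt_0_iff)
  qed
  define gam where "gam = inv_into V beta"
  have gam_V: "gam v \<in> V" and beta_gam: "beta (gam v) = v" if "v \<in> V" for v
    using that onto by (auto simp: gam_def inv_into_into f_inv_into_f)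
  have gam_eq: "gam v = w" if "w \<in> V" "beta w = v" for v w
    using that inj by (auto simp: gam_def)
  have gam_add: "gam (v + w) = gam v + gam w" if "v \<in> V" "w \<in> V" for v w
    using that by (intro gam_eq) (simp_all add: R.beta_add beta_gam gam_V R.vs.subspace_add[OF R.subspace_V])
  have gam_scale: "gam (scaleV d v) = scaleV d (gam v)" if "v \<in> V" for d v
    using that by (intro gam_eq) (simp_all add: R.beta_scale beta_gam gam_V R.vs.subspace_scale[OF R.subspace_V])
  \<comment> \<open>Any index will do: every pair of basis vectors with equal index brackets to
    \<open>z\<close>, and one exists because \<open>'m\<close> is nonempty.\<close>
  define i :: 'm where "i = undefined"
  define x :: "complex ^ ('m + 'm + unit)" where "x = axis (ix i) 1"
  define y :: "complex ^ ('m + 'm + unit)" where "y = axis (iy i) 1"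
  define S where "S = (\<lambda>v. gam (act x v))"
  define T where "T = (\<lambda>v. gam (act y v))"
  have xy: "heis_bracket x y = z"
    by (simp add: x_def y_def z_def heis_bracket_axis)
  have SV: "S v \<in> V" and TV: "T v \<in> V" if "v \<in> V" for v
    using that by (simp_all add: S_def T_def gam_V R.act_closed)
  have beta_diff: "beta (v - w) = beta v - beta w" if "v \<in> V" "w \<in> V" for v w
    using R.beta_add[of "v - w" w] that R.vs.subspace_diff[OF R.subspace_V] by simp
  \<comment> \<open>Writing \<open>act y v\<close> as \<open>beta (T v)\<close> lets
    \<open>act_alpha_beta\<close> remove the twist from \<open>x\<close>, and likewise with
    \<open>x\<close> and \<open>y\<close> exchanged. So \<open>act z (beta v)\<close> is
    \<open>beta\<close> applied twice to the commutator at \<open>v\<close>, and also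
    \<open>beta\<close> applied twice to \<open>scaleV c v\<close>.\<close>
  have comm: "S (T v) - T (S v) = scaleV c v" if v: "v \<in> V" for v
  proof -
    have aS: "act x w = beta (S w)" and aT: "act y w = beta (T w)" if "w \<in> V" for w
      using that by (simp_all add: S_def T_def beta_gam R.act_closed)
    have "act z (beta v) = beta (act x (T v)) - beta (act y (S v))"
      using R.act_bracket[OF v, of x y]
      by (simp add: xy aS[OF v] aT[OF v] R.act_alpha_beta SV TV v)
    also have "\<dots> = beta (beta (S (T v) - T (S v)))"
      by (simp add: aS aT beta_diff SV TV v R.beta_closed)
    finally have "beta (beta (S (T v) - T (S v))) = beta (beta (scaleV c v))"
      using v by (simp add: c R.beta_closed R.beta_scale)
    moreover have "S (T v) - T (S v) \<in> V" "scaleV c v \<in> V"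
      using v by (auto intro!: R.vs.subspace_diff R.vs.subspace_scale R.subspace_V SV TV)
    ultimately show ?thesis
      using inj R.beta_closed by (meson inj_onD)
  qed
  show False
  proof (rule R.vs.commutator_not_scalar[OF R.subspace_V F, of S T c])
    show "of_nat (R.vs.dim V) * c \<noteq> 0" using dim c0 by simp
  qed (simp_all add: SV TV comm, simp_all add: S_def T_def gam_add gam_scale R.act_closed
      R.act_add_right R.act_scale_right)
qed

theorem heis_faithful_dim_ge:
  fixes X Y :: "complex ^ 'm::finite ^ 'm"
    and scaleV :: "complex \<Rightarrow> 'v::ab_group_add \<Rightarrow> 'v"
  assumes rep: "faithful_hom_lie_representation (*s) heis_bracket ((*v) (heis_twist X Y lam))
      scaleV V act beta"
    and fd: "fin_dim scaleV V"
  shows "CARD('m) + 2 \<le> vector_space.dim scaleV V"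
proof -
  interpret R: faithful_hom_lie_representation "(*s)" heis_bracket "(*v) (heis_twist X Y lam)"
    scaleV V act beta by (rule rep)
  interpret P: vector_space_pair "(*s) :: complex \<Rightarrow> complex ^ ('m + 'm + unit) \<Rightarrow> _" scaleV
    by unfold_locales
  define z :: "complex ^ ('m + 'm + unit)" where "z = axis iz 1"
  have inj: "inj_on beta V" using R.beta_bij by (auto simp: bij_betw_def)
  obtain F where F: "finite F" "V \<subseteq> R.vs.span F" using fd by (auto simp: fin_dim_def)
  obtain v where v: "v \<in> V" and vz: "\<And>c. act z v \<noteq> scaleV c (beta v)"
    using heis_faithful_obtain_vector[OF rep fd] unfolding z_def by blast
  have bv: "beta v \<in> V" using v by (rule R.beta_closed)
  have beta0: "beta 0 = 0"
    using R.beta_scale[OF v, of 0] by simp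
  have bv0: "beta v \<noteq> 0"
  proof
    assume "beta v = 0"
    then have "v = 0" using inj_onD[OF inj] beta0 v R.vs.subspace_0[OF R.subspace_V] by metis
    then have "act z v = scaleV 0 (beta v)" using R.act_scale_right[OF v, of z 0] by simp
    then show False using vz by blast
  qed
  have lin: "Vector_Spaces.linear (*s) scaleV (\<lambda>u. act u v)"
    by unfold_locales (simp_all add: R.act_add_left R.act_scale_left v)
  define K where "K = {u. \<exists>c. act u v = scaleV c (beta v)}"
  have K_sub: "vec.subspace K"
  proof (rule vec.subspaceI)
    show "0 \<in> K"
      using R.act_scale_left[OF v, of 0 0] by (auto simp: K_def intro!: exI[of _ 0])
    show "u + w \<in> K" if "u \<in> K" "w \<in> K" for u w
      using that by (auto simp: K_def R.act_add_left[OF v] R.vs.scale_left_distrib[symmetric])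
    show "c *s u \<in> K" if "u \<in> K" for c u
      using that by (auto simp: K_def R.act_scale_left[OF v])
  qed
  \<comment> \<open>By \<open>act_bracket\<close> and \<open>act_alpha_beta\<close>, the bracket
    sends \<open>beta v\<close> to a difference of two terms, both \<open>c * d\<close> times
    \<open>beta (beta v)\<close>. Being a multiple of \<open>z\<close>, which does not kill
    \<open>beta v\<close>, the bracket is 0.\<close>
  have iso: "heis_bracket u w = 0" if u: "u \<in> K" and w: "w \<in> K" for u w
  proof -
    obtain c d where c: "act u v = scaleV c (beta v)" and d: "act w v = scaleV d (beta v)"
      using u w by (auto simp: K_def)
    obtain t where t: "heis_bracket u w = t *s z"
      by (simp add: heis_bracket_eq z_def)
    have "act (heis_bracket u w) (beta v) = 0"
      using R.act_bracket[OF v, of u w]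
      by (simp add: c d R.act_scale_right bv R.act_alpha_beta[OF v] R.beta_scale mult.commute)
    then have 0: "scaleV t (act z (beta v)) = 0"
      by (simp add: t R.act_scale_left bv)
    have "act z (beta v) \<noteq> 0"
    proof
      assume "act z (beta v) = 0"
      then have "beta (act z v) = 0"
        using R.act_alpha_beta[OF v, of z] by (simp add: z_def heis_twist_iz R.act_scale_left bv)
      then have "act z v = 0"
        using inj_onD[OF inj] beta0 R.act_closed[OF v] R.vs.subspace_0[OF R.subspace_V] by metis
      then show False using vz[of 0] by simp
    qed
    then show ?thesis using 0 t by simp
  qed
  have zK: "t = 0" if "t *s z \<in> K" for t
  proof (rule ccontr)
    assume t: "t \<noteq> 0"
    then have "inverse t *s (t *s z) \<in> K" using that vec.subspace_scale[OF K_sub] by blast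
    then show False using t vz by (simp add: K_def)
  qed
  \<comment> \<open>The kernel of \<open>heis_conj\<close> is the line of \<open>z\<close>, which
    meets \<open>K\<close> only in 0.\<close>
  have conj_inj: "k = 0" if "k \<in> K" "heis_conj k = 0" for k
  proof -
    have "k = (k $ iz) *s z"
      using that(2) by (simp add: heis_conj_eq_0_iff heis_vec_eq_iff z_def axis_def)
    then show ?thesis using zK that(1) by (metis vec.scale_zero_left)
  qed
  obtain B where B: "B \<subseteq> K" "vec.independent B" "K \<subseteq> vec.span B"
    using vec.basis_exists by metis
  have finB: "finite B" using B(2) by (rule vec.finiteI_independent)

  \<comment> \<open>First inequality: \<open>?E - B\<close> spans a complement of
    \<open>K\<close>.\<close>
  let ?E = "vec.extend_basis B"
  have E: "vec.independent ?E" "B \<subseteq> ?E" "vec.span ?E = UNIV"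
    using B(2) by (simp_all add: vec.independent_extend_basis vec.extend_basis_superset)
  have "card ?E = vec.dim (UNIV :: (complex ^ ('m + 'm + unit)) set)"
    using vec.dim_eq_card[of ?E UNIV] E by simp
  then have cardE: "card ?E = 2 * CARD('m) + 1"
    by (simp add: card_cart_basis)
  have "card (?E - B) < R.vs.dim V"
  proof (rule P.card_less_dim[OF lin _ R.subspace_V F _ bv bv0])
    show "vec.independent (?E - B)" using E(1) vec.independent_mono by blast
    show "act u v \<in> V" for u using v by (rule R.act_closed)
    show "u = 0" if "u \<in> vec.span (?E - B)" "act u v = scaleV c (beta v)" for u c
      using vec.span_disjoint_independent[OF E(1) _ that(1) E(2)] B(3) that(2) by (auto simp: K_def)
  qed
  then have 1: "2 * CARD('m) + 2 \<le> R.vs.dim V + card B"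
    using cardE E(2) finB by (simp add: card_Diff_subset)

  \<comment> \<open>Second inequality: the span of \<open>z\<close> and the rotated
    \<open>K\<close>. Since \<open>heis_conj\<close> is conjugate-linear, a linear relation among
    the images pulls back with conjugated coefficients.\<close>
  have conj_inj_on: "inj_on heis_conj B"
  proof (rule inj_onI)
    fix a b assume ab: "a \<in> B" "b \<in> B" "heis_conj a = heis_conj b"
    then have "heis_conj (a - b) = 0" by (simp add: heis_vec_eq_iff)
    then show "a = b" using conj_inj vec.subspace_diff[OF K_sub] ab B(1) by fastforce
  qed
  have indB: "vec.independent (heis_conj ` B)"
  proof (rule vec.independent_if_scalars_zero)
    show "finite (heis_conj ` B)" using finB by simp
    fix f x assume "(\<Sum>x\<in>heis_conj ` B. f x *s x) = 0" and x: "x \<in> heis_conj ` B"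
    then have "heis_conj (\<Sum>b\<in>B. cnj (f (heis_conj b)) *s b) = 0"
      by (simp add: heis_conj_sum sum.reindex conj_inj_on)
    moreover have "(\<Sum>b\<in>B. cnj (f (heis_conj b)) *s b) \<in> K"
      using B(1) by (intro vec.subspace_sum vec.subspace_scale K_sub) auto
    ultimately have "(\<Sum>b\<in>B. cnj (f (heis_conj b)) *s b) = 0" using conj_inj by blast
    then have "\<forall>b\<in>B. cnj (f (heis_conj b)) = 0"
      using B(2)[unfolded vec.independent_explicit, THEN conjunct2,
          THEN spec, of "\<lambda>b. cnj (f (heis_conj b))"] by simp
    then show "f x = 0" using x by auto
  qed
  have "vec.subspace (heis_conj ` K)"
  proof (rule vec.subspaceI)
    show "0 \<in> heis_conj ` K"
      using vec.subspace_0[OF K_sub] heis_conj_eq_0_iff[of 0] by force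
    show "a + b \<in> heis_conj ` K" if "a \<in> heis_conj ` K" "b \<in> heis_conj ` K" for a b
      using that vec.subspace_add[OF K_sub] by (auto simp: heis_conj_add[symmetric])
    show "c *s a \<in> heis_conj ` K" if a: "a \<in> heis_conj ` K" for c a
    proof -
      obtain k where "k \<in> K" "a = heis_conj k" using a by blast
      then have "c *s a = heis_conj (cnj c *s k)" "cnj c *s k \<in> K"
        using vec.subspace_scale[OF K_sub] by (simp_all add: heis_conj_scale)
      then show ?thesis by blast
    qed
  qed
  then have spB: "vec.span (heis_conj ` B) \<subseteq> heis_conj ` K"
    using B(1) by (intro vec.span_minimal) auto
  have zB: "z \<notin> vec.span (heis_conj ` B)"
    using spB by (auto simp: z_def heis_vec_eq_iff axis_def)
  have "card (insert z (heis_conj ` B)) < R.vs.dim V"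
  proof (rule P.card_less_dim[OF lin _ R.subspace_V F _ bv bv0])
    show "vec.independent (insert z (heis_conj ` B))"
      using zB indB by (rule vec.independent_insertI)
    show "act u v \<in> V" for u using v by (rule R.act_closed)
    fix u c
    assume u: "u \<in> vec.span (insert z (heis_conj ` B))" and "act u v = scaleV c (beta v)"
    then have uK: "u \<in> K" by (auto simp: K_def)
    \<comment> \<open>As \<open>z\<close> is central, pairing \<open>u\<close> with \<open>k\<close>
      leaves only the Hermitian square of \<open>k\<close>, which vanishes because \<open>K\<close>
      is isotropic.\<close>
    obtain t k where t: "u - t *s z = heis_conj k" and k: "k \<in> K"
      using u spB by (auto simp: vec.span_insert)
    have "heis_bracket k u = heis_bracket k (heis_conj k)"
      by (simp add: t[symmetric] heis_bracket_eq z_def axis_def)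
    then have "heis_conj k = 0"
      using iso[OF k uK] heis_bracket_conj_eq_0[of k] by simp
    then have "u = t *s z" using t by simp
    then show "u = 0" using zK uK by (metis vec.scale_zero_left)
  qed
  moreover have "z \<notin> heis_conj ` B" using zB vec.span_base by blast
  ultimately have "card B + 2 \<le> R.vs.dim V"
    using finB conj_inj_on by (simp add: card_image)
  with 1 show ?thesis by simp
qed

section \<open>Upper bound: a faithful representation of dimension m + 2\<close>

text \<open>The coordinates are ordered \<open>Inr True\<close>, \<open>Inl i\<close>,
  \<open>Inr False\<close>. The map is \<open>heis_rep_beta\<close> after the strictly upper
  triangular matrix with the \<open>x\<close> part as top row, the \<open>y\<close> part as last
  column and \<open>lam * u $ iz\<close> in the corner. The factor \<open>lam\<close> there matches
  the one that the twist puts on the pairing of \<open>x\<close> and \<open>y\<close> parts.\<close>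

definition heis_rep_act ::
  "complex ^ 'm ^ 'm \<Rightarrow> complex \<Rightarrow> complex ^ ('m::finite + 'm + unit)
    \<Rightarrow> complex ^ ('m + bool) \<Rightarrow> complex ^ ('m + bool)" where
  "heis_rep_act Y lam u v = (\<chi> p. case p of
       Inl i \<Rightarrow> (Y *v (\<chi> j. u $ iy j)) $ i * v $ Inr False
     | Inr True \<Rightarrow> lam * ((\<Sum>i\<in>UNIV. u $ ix i * v $ Inl i) + lam * u $ iz * v $ Inr False)
     | Inr False \<Rightarrow> 0)"

definition heis_rep_beta ::
  "complex ^ 'm ^ 'm \<Rightarrow> complex \<Rightarrow> complex ^ ('m::finite + bool) \<Rightarrow> complex ^ ('m + bool)" where
  "heis_rep_beta Y lam v = (\<chi> p. case p of
       Inl i \<Rightarrow> (Y *v (\<chi> j. v $ Inl j)) $ i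
     | Inr True \<Rightarrow> lam * v $ Inr True
     | Inr False \<Rightarrow> v $ Inr False)"

lemma heis_rep_act_nth:
  "heis_rep_act Y lam u v $ Inl i = (Y *v (\<chi> j. u $ iy j)) $ i * v $ Inr False"
  "heis_rep_act Y lam u v $ Inr True
    = lam * ((\<Sum>i\<in>UNIV. u $ ix i * v $ Inl i) + lam * u $ iz * v $ Inr False)"
  "heis_rep_act Y lam u v $ Inr False = 0"
  by (simp_all add: heis_rep_act_def)

lemma heis_rep_beta_nth:
  "heis_rep_beta Y lam v $ Inl i = (Y *v (\<chi> j. v $ Inl j)) $ i"
  "heis_rep_beta Y lam v $ Inr True = lam * v $ Inr True"
  "heis_rep_beta Y lam v $ Inr False = v $ Inr False"
  by (simp_all add: heis_rep_beta_def)

lemma heis_rep_vec_eq_iff: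
  "u = v \<longleftrightarrow> (\<forall>i. u $ Inl i = v $ Inl i) \<and> u $ Inr True = v $ Inr True
    \<and> u $ Inr False = v $ Inr False"
  for u v :: "complex ^ ('m::finite + bool)"
  by (auto simp: vec_eq_iff split_sum_all all_bool_eq)

lemma vec_lambda_linear:
  "(\<chi> i. f i + g i) = (\<chi> i. f i) + (\<chi> i. g i)"
  "(\<chi> i. c * f i) = c *s (\<chi> i. f i)"
  for f g :: "'n::finite \<Rightarrow> 'a::semiring_1"
  by (simp_all add: vec_eq_iff)

lemma sum_matrix_vector_mult_transpose:
  "(\<Sum>i\<in>UNIV. (X *v a) $ i * w $ i) = (\<Sum>j\<in>UNIV. a $ j * (transpose X *v w) $ j)"
  for X :: "'a::comm_semiring_1 ^ 'n::finite ^ 'm::finite"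
proof -
  have "(\<Sum>i\<in>UNIV. (X *v a) $ i * w $ i) = (\<Sum>i\<in>UNIV. \<Sum>j\<in>UNIV. a $ j * (X $ i $ j * w $ i))"
    by (simp add: matrix_vector_mult_def sum_distrib_left sum_distrib_right mult_ac)
  also have "\<dots> = (\<Sum>j\<in>UNIV. \<Sum>i\<in>UNIV. a $ j * (X $ i $ j * w $ i))"
    by (rule sum.swap)
  also have "\<dots> = (\<Sum>j\<in>UNIV. a $ j * (transpose X *v w) $ j)"
    by (simp add: matrix_vector_mult_def transpose_def sum_distrib_left)
  finally show ?thesis .
qed

lemma mat_matrix_vector_mult: "mat c *v v = c *s v" for c :: "'a::comm_semiring_1"
  by (simp add: vec_eq_iff matrix_vector_mult_def mat_def if_distrib[of "\<lambda>x. x * _"] cong: if_cong)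

lemma heis_faithful_rep:
  fixes X Y :: "complex ^ 'm::finite ^ 'm"
  assumes lam: "lam \<noteq> 0" and XY: "transpose X ** Y = mat lam"
  shows "faithful_hom_lie_representation (*s) heis_bracket ((*v) (heis_twist X Y lam))
    (*s) UNIV (heis_rep_act Y lam) (heis_rep_beta Y lam)"
proof -
  interpret H: multiplicative_hom_lie_algebra "(*s)" heis_bracket "(*v) (heis_twist X Y lam)"
    using XY by (rule heis_multiplicative_hom_lie_algebra)
  have XYv: "transpose X *v (Y *v w) = lam *s w" for w
    by (simp add: matrix_vector_mul_assoc XY mat_matrix_vector_mult)
  \<comment> \<open>The form in which the hypothesis on \<open>X\<close> and \<open>Y\<close> enters
    both representation axioms, in the top coordinate.\<close>
  have pair: "(\<Sum>i\<in>UNIV. (X *v a) $ i * (Y *v b) $ i) = lam * (\<Sum>i\<in>UNIV. a $ i * b $ i)" for a b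
    by (simp add: sum_matrix_vector_mult_transpose XYv sum_distrib_left mult_ac
        del: transpose_matrix_vector)
  have Y0: "w = 0" if "Y *v w = 0" for w
    using XYv[of w] that lam by simp
  have beta_add: "heis_rep_beta Y lam (v + w) = heis_rep_beta Y lam v + heis_rep_beta Y lam w" for v w
    by (simp add: heis_rep_vec_eq_iff heis_rep_beta_nth vec_lambda_linear
        matrix_vector_right_distrib algebra_simps)
  have beta_scale: "heis_rep_beta Y lam (c *s v) = c *s heis_rep_beta Y lam v" for c v
    by (simp add: heis_rep_vec_eq_iff heis_rep_beta_nth vec_lambda_linear vector_scalar_commute)
  have beta_lin: "Vector_Spaces.linear (*s) (*s) (heis_rep_beta Y lam)"
    by unfold_locales (simp_all add: beta_add beta_scale)
  have beta_inj: "inj (heis_rep_beta Y lam)"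
  proof (subst vec.linear_inj_iff_eq_0[OF beta_lin], intro allI impI)
    fix v assume v: "heis_rep_beta Y lam v = 0"
    then have "Y *v (\<chi> j. v $ Inl j) = 0"
      by (simp add: heis_rep_vec_eq_iff heis_rep_beta_nth vec_eq_iff)
    then have "(\<chi> j. v $ Inl j) = 0" by (rule Y0)
    then show "v = 0" using v lam
      by (simp add: heis_rep_vec_eq_iff heis_rep_beta_nth vec_eq_iff)
  qed
  show ?thesis
  proof (unfold_locales, goal_cases)
    case 1 show ?case by (rule vec.subspace_UNIV)
  next
    case (3 v w) show ?case by (rule beta_add)
  next
    case (4 v c) show ?case by (rule beta_scale)
  next
    case (6 v x y) show ?case
      by (simp add: heis_rep_vec_eq_iff heis_rep_act_nth vec_lambda_linear sum.distrib
        matrix_vector_right_distrib algebra_simps)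
  next
    case (7 v c x) show ?case
      by (simp add: heis_rep_vec_eq_iff heis_rep_act_nth vec_lambda_linear vector_scalar_commute
        sum_distrib_left algebra_simps)
  next
    case (8 v w x) show ?case
      by (simp add: heis_rep_vec_eq_iff heis_rep_act_nth sum.distrib algebra_simps)
  next
    case (9 v x c) show ?case
      by (simp add: heis_rep_vec_eq_iff heis_rep_act_nth sum_distrib_left algebra_simps)
  next
    case (10 v x) show ?case
      by (simp add: heis_rep_vec_eq_iff heis_rep_act_nth heis_rep_beta_nth heis_twist_nth pair
        vec_lambda_eta mult.commute[of _ "v $ Inr False"] vec_lambda_linear vector_scalar_commute
        algebra_simps)
  next
    case (11 v x y) show ?case
      by (simp add: heis_rep_vec_eq_iff heis_rep_act_nth heis_rep_beta_nth heis_twist_nth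
        heis_bracket_eq axis_def zero_vec_def[symmetric] mult.assoc[symmetric]
        sum_distrib_right[symmetric] pair sum_subtractf)
        (simp add: algebra_simps)
  next
    case 12 show ?case
      using beta_inj vec.linear_injective_imp_surjective[OF beta_lin beta_inj] by (simp add: bij_betw_def)
  next
    case 13 show ?case
    proof (rule injI)
      fix u w assume "restrict (heis_rep_act Y lam u) UNIV = restrict (heis_rep_act Y lam w) UNIV"
      then have eq: "heis_rep_act Y lam u v = heis_rep_act Y lam w v" for v by (metis UNIV_I restrict_apply')
      \<comment> \<open>Faithfulness is read off from basis vectors: the middle ones detect the
        \<open>x\<close> part, and the last one detects \<open>z\<close> and, as \<open>Y\<close> is
        injective, the \<open>y\<close> part.\<close>
      have "u $ ix i = w $ ix i" for i
        using arg_cong[OF eq[of "axis (Inl i) 1"], of "\<lambda>v. v $ Inr True"] lam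
        by (simp add: heis_rep_act_nth axis_def if_distrib cong: if_cong)
      moreover have "u $ iz = w $ iz"
        using arg_cong[OF eq[of "axis (Inr False) 1"], of "\<lambda>v. v $ Inr True"] lam
        by (simp add: heis_rep_act_nth axis_def)
      moreover have "Y *v ((\<chi> j. u $ iy j) - (\<chi> j. w $ iy j)) = 0"
        using arg_cong[OF eq[of "axis (Inr False) 1"], of "\<lambda>v. v $ Inl _"]
        by (simp add: vec_eq_iff matrix_vector_mult_diff_distrib heis_rep_act_nth axis_def)
      then have "u $ iy i = w $ iy i" for i
        using Y0[of "(\<chi> j. u $ iy j) - (\<chi> j. w $ iy j)"] by (simp add: vec_eq_iff)
      ultimately show "u = w" by (simp add: heis_vec_eq_iff)
    qed
  qed simp_all
qed

theorem theorem5p4: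
  fixes X Y :: "complex ^ 'm::finite ^ 'm" and lam :: complex
  assumes "lam \<noteq> 0"
    and "transpose X ** Y = mat lam"
  shows "min_faithful_dim (*s) heis_bracket ((*v) (heis_twist X Y lam)) = enat (CARD('m) + 2)"
proof (subst min_faithful_dim_eq_enat_iff, intro conjI ballI)
  have "faithful_rep_on (*s) heis_bracket ((*v) (heis_twist X Y lam)) (*s)
      (UNIV :: (complex ^ ('m + bool)) set)"
    using heis_faithful_rep[OF assms] by (auto simp: faithful_rep_on_def)
  moreover have "fin_dim (*s) (UNIV :: (complex ^ ('m + bool)) set)"
    unfolding fin_dim_def using vec.finite_Basis vec.span_Basis by blast
  \<comment> \<open>The explicit representation is carried over to a space of sequences, where
    \<open>faithful_rep_dims\<close> is defined.\<close>
  ultimately have "vec.dim (UNIV :: (complex ^ ('m + bool)) set)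
      \<in> faithful_rep_dims (*s) heis_bracket ((*v) (heis_twist X Y lam))"
    by (rule faithful_rep_dims_complete)
  then show "CARD('m) + 2 \<in> faithful_rep_dims (*s) heis_bracket ((*v) (heis_twist X Y lam))"
    by (simp add: card_cart_basis)
next
  fix k assume "k \<in> faithful_rep_dims (*s) heis_bracket ((*v) (heis_twist X Y lam))"
  then show "CARD('m) + 2 \<le> k"
    using heis_faithful_dim_ge
    by (fastforce simp: faithful_rep_dims_def faithful_rep_on_def)
qed

end
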